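(* Let $\mathcal{P}$ be a finite set of price vectors, let $\mathcal{U}$ be a convex set, and suppose $R(\mathbf{p},\mathbf{u})$ is convex in $\mathbf{u}\in\mathcal{U}$ for every $\mathbf{p}\in\mathcal{P}$. Let $K_1,K_2$ be nonnegative integers, let $g_1,\dots,g_{K_1},h_1,\dots,h_{K_2}:\mathcal{P}\to\mathbb{R}$, let $c_1,\dots,c_{K_1},d_1,\dots,d_{K_2}\in\mathbb{R}$, and let $$\tilde\Delta_{\mathcal{P}} = \Big\{\boldsymbol{\pi}\in\Delta_{\mathcal{P}} : \sum_{\mathbf{p}\in\mathcal{P}} g_k(\mathbf{p})\pi_{\mathbf{p}} = c_k\ \forall k\in[K_1],\ \sum_{\mathbf{p}\in\mathcal{P}} h_k(\mathbf{p})\pi_{\mathbf{p}} \le d_k\ \forall k\in[K_2]\Big\},$$ assumed nonempty. Then the optimal value of $$\max_{\boldsymbol{\pi}\in\tilde\Delta_{\mathcal{P}}} \min_{\mathbf{u}\in\mathcal{U}} \sum_{\mathbf{p}\in\mathcal{P}} \pi_{\mathbf{p}} R(\mathbf{p},\mathbf{u})$$ equals the optimal value of the convex optimization problem $$\text{minimize}\quad t - \sum_{k=1}^{K_1}\lambda_k c_k - \sum_{k=1}^{K_2}\rho_k d_k$$ over $\boldsymbol{\lambda}\in\mathbb{R}^{K_1}$, $\boldsymbol{\rho}\in\mathbb{R}^{K_2}$ with $\boldsymbol{\rho}\le\mathbf{0}$ (componentwise), $t\in\mathbb{R}$, $\mathbf{u}\in\mathcal{U}$, subject to $$t \ge R(\mathbf{p},\mathbf{u})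 + \sum_{k=1}^{K_1}\lambda_k g_k(\mathbf{p}) + \sum_{k=1}^{K_2}\rho_k h_k(\mathbf{p})\quad \forall\,\mathbf{p}\in\mathcal{P}.$$
   Context: $\mathcal{P}\subseteq\mathbb{R}_+^I$ is (nonempty and) finite, $\mathcal{U}\subseteq\mathbb{R}^M$ is (nonempty and) convex, $R:\mathcal{P}\times\mathcal{U}\to\mathbb{R}$, $[K]=\{1,\dots,K\}$, and $\Delta_{\mathcal{P}} = \{\boldsymbol{\pi}\in\mathbb{R}^{\mathcal{P}} : \sum_{\mathbf{p}\in\mathcal{P}}\pi_{\mathbf{p}}=1,\ \pi_{\mathbf{p}}\ge 0\ \forall \mathbf{p}\in\mathcal{P}\}$. Optimal values are understood as suprema/infima. *)

theory Defs
  imports "HOL-Analysis.Analysis"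
begin

text \<open>
  \<open>\<real>\<^sup>A\<close> for an explicit index set \<open>A\<close> is rendered as the extensional function space
  \<open>A \<rightarrow>\<^sub>E UNIV\<close>.  In particular \<open>\<real>\<^sup>K\<close> is \<open>{1..K} \<rightarrow>\<^sub>E UNIV\<close>, which also covers
  \<open>K = 0\<close> (a single point).
\<close>

definition prob_simplex :: "'p set \<Rightarrow> ('p \<Rightarrow> real) set" where
  "prob_simplex P = {\<pi> \<in> P \<rightarrow>\<^sub>E UNIV. (\<Sum>p\<in>P. \<pi> p) = 1 \<and> (\<forall>p\<in>P. 0 \<le> \<pi> p)}"

definition constrained_simplex ::
  "'p set \<Rightarrow> nat \<Rightarrow> nat \<Rightarrow> (nat \<Rightarrow> 'p \<Rightarrow> real) \<Rightarrow> (nat \<Rightarrow> 'p \<Rightarrow> real)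
    \<Rightarrow> (nat \<Rightarrow> real) \<Rightarrow> (nat \<Rightarrow> real) \<Rightarrow> ('p \<Rightarrow> real) set" where
  "constrained_simplex P K1 K2 g h c d =
     {\<pi> \<in> prob_simplex P.
        (\<forall>k\<in>{1..K1}. (\<Sum>p\<in>P. g k p * \<pi> p) = c k) \<and>
        (\<forall>k\<in>{1..K2}. (\<Sum>p\<in>P. h k p * \<pi> p) \<le> d k)}"

definition feasible_set ::
  "'p set \<Rightarrow> 'u set \<Rightarrow> ('p \<Rightarrow> 'u \<Rightarrow> real) \<Rightarrow> nat \<Rightarrow> nat
    \<Rightarrow> (nat \<Rightarrow> 'p \<Rightarrow> real) \<Rightarrow> (nat \<Rightarrow> 'p \<Rightarrow> real)
    \<Rightarrow> ((nat \<Rightarrow> real) \<times> (nat \<Rightarrow> real) \<times> real \<times> 'u) set" where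
  "feasible_set P U R K1 K2 g h =
     {(l, \<rho>, t, u). l \<in> {1..K1} \<rightarrow>\<^sub>E UNIV \<and> \<rho> \<in> {1..K2} \<rightarrow>\<^sub>E UNIV \<and>
        (\<forall>k\<in>{1..K2}. \<rho> k \<le> 0) \<and> u \<in> U \<and>
        (\<forall>p\<in>P. t \<ge> R p u + (\<Sum>k=1..K1. l k * g k p) + (\<Sum>k=1..K2. \<rho> k * h k p))}"

definition objective ::
  "nat \<Rightarrow> nat \<Rightarrow> (nat \<Rightarrow> real) \<Rightarrow> (nat \<Rightarrow> real)
    \<Rightarrow> (nat \<Rightarrow> real) \<times> (nat \<Rightarrow> real) \<times> real \<times> 'u \<Rightarrow> real" where
  "objective K1 K2 c d = (\<lambda>(l, \<rho>, t, u). t - (\<Sum>k=1..K1. l k * c k) - (\<Sum>k=1..K2. \<rho> k * d k))"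

text \<open>
  The function type \<open>nat \<Rightarrow> real\<close> is not an instance of \<^class>\<open>real_vector\<close>, so convexity of a
  set of, and of a function on, tuples in \<open>\<real>\<^sup>K1 \<times> \<real>\<^sup>K2 \<times> \<real> \<times> 'u\<close> is spelled out using the
  componentwise convex combination.
\<close>

definition tuple_comb ::
  "nat \<Rightarrow> nat \<Rightarrow> real \<Rightarrow> (nat \<Rightarrow> real) \<times> (nat \<Rightarrow> real) \<times> real \<times> 'u::real_vector
    \<Rightarrow> (nat \<Rightarrow> real) \<times> (nat \<Rightarrow> real) \<times> real \<times> 'u
    \<Rightarrow> (nat \<Rightarrow> real) \<times> (nat \<Rightarrow> real) \<times> real \<times> 'u" where
  "tuple_comb K1 K2 s = (\<lambda>(l, \<rho>, t, u) (l', \<rho>', t', u').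
     (\<lambda>k\<in>{1..K1}. (1 - s) * l k + s * l' k,
      \<lambda>k\<in>{1..K2}. (1 - s) * \<rho> k + s * \<rho>' k,
      (1 - s) * t + s * t',
      (1 - s) *\<^sub>R u + s *\<^sub>R u'))"

definition convex_program ::
  "nat \<Rightarrow> nat \<Rightarrow> ((nat \<Rightarrow> real) \<times> (nat \<Rightarrow> real) \<times> real \<times> 'u::real_vector) set
    \<Rightarrow> ((nat \<Rightarrow> real) \<times> (nat \<Rightarrow> real) \<times> real \<times> 'u \<Rightarrow> real) \<Rightarrow> bool" where
  "convex_program K1 K2 F f \<longleftrightarrow>
     (\<forall>x\<in>F. \<forall>y\<in>F. \<forall>s\<in>{0..1}.
        tuple_comb K1 K2 s x y \<in> F \<and>
        f (tuple_comb K1 K2 s x y) \<le> (1 - s) * f x + s * f y)"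

end

theory Submission imports Defs begin

text \<open>
  Weak duality is the usual exchange of sums.  For the converse let \<open>v\<close> be a real number below the
  minimum.  On the simplex every constraint can be homogenised with \<open>\<Sum>\<pi> = 1\<close>, so for finitely many
  \<open>u\<^sub>j\<close> Farkas' lemma either produces \<open>\<pi>\<close> in the constrained simplex with
  \<open>\<Sum>\<pi>\<^sub>p R(p,u\<^sub>j) \<ge> v\<close> for all \<open>j\<close>, or multipliers; by convexity of \<open>R\<close> the multipliers, together with
  the weighted mean of the \<open>u\<^sub>j\<close>, form a feasible point with objective value \<open>v\<close>, which is excluded.
  Compactness of the constrained simplex passes from finitely many \<open>u\<^sub>j\<close> to all of \<open>U\<close>.
\<close>

section \<open>Farkas' lemma for finitely many functionals\<close>

text \<open>
  Bartl's algebraic proof, by induction on the number of functionals: if the vector \<open>x\<close> obtained for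
  \<open>I\<close> violates the new functional \<open>a j\<close>, project all functionals along \<open>x\<close> onto the kernel of
  \<open>a j\<close> and apply the induction hypothesis again.
\<close>

lemma farkas_finite:
  fixes a :: "'k \<Rightarrow> 'p \<Rightarrow> real" and b :: "'p \<Rightarrow> real"
  assumes "finite I" and "finite P"
  shows "(\<exists>l. (\<forall>i\<in>I. 0 \<le> l i) \<and> (\<forall>p\<in>P. b p = (\<Sum>i\<in>I. l i * a i p))) \<or>
         (\<exists>x. (\<forall>i\<in>I. (\<Sum>p\<in>P. a i p * x p) \<le> 0) \<and> 0 < (\<Sum>p\<in>P. b p * x p))"
  using assms(1)
proof (induction I arbitrary: a b rule: finite_induct)
  case empty
  show ?case
  proof (cases "\<forall>p\<in>P. b p = 0")
    case False
    then obtain q where q: "q \<in> P" "b q \<noteq> 0" by blast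
    have "0 < (\<Sum>p\<in>P. b p * b p)"
      using q assms(2) by (intro sum_pos2[of P q]) (auto simp: zero_less_mult_iff not_less less_le)
    then show ?thesis by auto
  qed simp
next
  case (insert j I)
  define D where "D f x = (\<Sum>p\<in>P. f p * x p)" for f x :: "'p \<Rightarrow> real"
  have D_diff_left: "D (\<lambda>p. f p - r * f' p) x = D f x - r * D f' x" for f f' x r
    by (simp add: D_def left_diff_distrib sum_subtractf sum_distrib_left mult.assoc)
  have D_diff_right: "D f (\<lambda>p. y p - r * x p) = D f y - r * D f x" for f x y r
    by (simp add: D_def right_diff_distrib sum_subtractf sum_distrib_left mult.left_commute)
  have D_scale: "D f (\<lambda>p. r * x p) = r * D f x" for f x r
    by (simp add: D_def sum_distrib_left mult.left_commute)
  show ?case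
  proof (rule disjCI)
    assume no: "\<not> (\<exists>x. (\<forall>i\<in>insert j I. (\<Sum>p\<in>P. a i p * x p) \<le> 0) \<and> 0 < (\<Sum>p\<in>P. b p * x p))"
    have no': "\<not> 0 < D b x" if "D (a j) x \<le> 0" "\<forall>i\<in>I. D (a i) x \<le> 0" for x
      using no that unfolding D_def by blast
    show "\<exists>l. (\<forall>i\<in>insert j I. 0 \<le> l i) \<and> (\<forall>p\<in>P. b p = (\<Sum>i\<in>insert j I. l i * a i p))"
    proof (cases "\<exists>l. (\<forall>i\<in>I. 0 \<le> l i) \<and> (\<forall>p\<in>P. b p = (\<Sum>i\<in>I. l i * a i p))")
      case True
      then obtain l where l: "\<forall>i\<in>I. 0 \<le> l i" "\<forall>p\<in>P. b p = (\<Sum>i\<in>I. l i * a i p)" by blast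
      have "(\<Sum>i\<in>insert j I. (l(j := 0)) i * a i p) = (\<Sum>i\<in>I. l i * a i p)" for p
        using insert.hyps by (auto intro!: sum.cong)
      with l show ?thesis by (intro exI[of _ "l(j := 0)"]) auto
    next
      case False
      then obtain x0 where x0: "\<forall>i\<in>I. D (a i) x0 \<le> 0" "0 < D b x0"
        using insert.IH[of b a] unfolding D_def by blast
      then have pos: "0 < D (a j) x0" using no'[of x0] by linarith
      define x where "x = (\<lambda>p. (1 / D (a j) x0) * x0 p)"
      have x: "D (a j) x = 1" "\<forall>i\<in>I. D (a i) x \<le> 0" "0 < D b x"
        unfolding x_def D_scale using x0 pos by (auto simp: divide_simps)
      \<comment> \<open>Since \<open>D (a j) x = 1\<close>, sending \<open>y\<close> to
        \<open>y - D (a j) y * x\<close> projects onto the kernel of \<open>a j\<close>. The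
        functionals \<open>a' i\<close> and \<open>b'\<close> are \<open>a i\<close> and
        \<open>b\<close> composed with this projection.\<close>
      define a' where "a' = (\<lambda>i p. a i p - D (a i) x * a j p)"
      define b' where "b' = (\<lambda>p. b p - D b x * a j p)"
      have "\<not> (\<exists>y. (\<forall>i\<in>I. D (a' i) y \<le> 0) \<and> 0 < D b' y)"
      proof
        assume "\<exists>y. (\<forall>i\<in>I. D (a' i) y \<le> 0) \<and> 0 < D b' y"
        then obtain y where y: "\<forall>i\<in>I. D (a' i) y \<le> 0" "0 < D b' y" by blast
        show False
          using no'[of "\<lambda>p. y p - D (a j) y * x p"] y x(1)
          unfolding a'_def b'_def D_diff_left D_diff_right by (simp add: mult.commute)
      qed
      then obtain l where l: "\<forall>i\<in>I. 0 \<le> l i" "\<forall>p\<in>P. b' p = (\<Sum>i\<in>I. l i * a' i p)"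
        using insert.IH[of b' a'] unfolding D_def by blast
      \<comment> \<open>Undoing the projection collects the multiples of \<open>a j\<close> that
        were subtracted from \<open>b\<close> and from each \<open>a i\<close>. The resulting
        coefficient is nonnegative because \<open>D b x\<close> is positive and each
        \<open>D (a i) x\<close> with \<open>i\<close> in \<open>I\<close> is at most 0.\<close>
      define l' where "l' = l(j := D b x - (\<Sum>i\<in>I. l i * D (a i) x))"
      have "(\<Sum>i\<in>I. l i * D (a i) x) \<le> 0"
        using l(1) x(2) by (intro sum_nonpos) (auto simp: mult_nonneg_nonpos)
      then have "\<forall>i\<in>insert j I. 0 \<le> l' i"
        using l(1) x(3) by (auto simp: l'_def)
      moreover have "b p = (\<Sum>i\<in>insert j I. l' i * a i p)" if "p \<in> P" for p
      proof -
        have "(\<Sum>i\<in>I. l' i * a i p) = (\<Sum>i\<in>I. l i * a i p)"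
          using insert.hyps by (auto intro!: sum.cong simp: l'_def)
        moreover have "b p - D b x * a j p
            = (\<Sum>i\<in>I. l i * a i p) - (\<Sum>i\<in>I. l i * D (a i) x) * a j p"
          using l(2) that
          by (simp add: a'_def b'_def right_diff_distrib sum_subtractf sum_distrib_right mult.assoc)
        ultimately show ?thesis
          using insert.hyps by (simp add: l'_def algebra_simps)
      qed
      ultimately show ?thesis by blast
    qed
  qed
qed

section \<open>Weak duality\<close>

lemma sum_sum_mult_swap:
  fixes f :: "'k \<Rightarrow> real" and A :: "'k \<Rightarrow> 'p \<Rightarrow> real"
  shows "(\<Sum>p\<in>P. x p * (\<Sum>k\<in>S. f k * A k p)) = (\<Sum>k\<in>S. f k * (\<Sum>p\<in>P. A k p * x p))"
  unfolding sum_distrib_left by (subst sum.swap) (simp add: mult_ac)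

lemma constrained_simplex_eqs:
  assumes "\<pi> \<in> constrained_simplex P K1 K2 g h c d"
  shows "(\<Sum>p\<in>P. \<pi> p) = 1" and "\<And>p. p \<in> P \<Longrightarrow> 0 \<le> \<pi> p"
    and "\<And>k. k \<in> {1..K1} \<Longrightarrow> (\<Sum>p\<in>P. g k p * \<pi> p) = c k"
    and "\<And>k. k \<in> {1..K2} \<Longrightarrow> (\<Sum>p\<in>P. h k p * \<pi> p) \<le> d k"
  using assms by (auto simp: constrained_simplex_def prob_simplex_def)

text \<open>Averaging the epigraph constraints with weights \<open>\<pi> p\<close> and exchanging
  sums replaces \<open>g\<close> and \<open>h\<close> by their means. The equality terms match for
  multipliers \<open>l\<close> of any sign, while \<open>\<rho> \<le> 0\<close> reverses the
  inequalities for \<open>h\<close> into the required direction.\<close>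

lemma weak_duality:
  assumes pi: "\<pi> \<in> constrained_simplex P K1 K2 g h c d"
    and feas: "(l, \<rho>, t, u) \<in> feasible_set P U R K1 K2 g h"
  shows "(\<Sum>p\<in>P. \<pi> p * R p u) \<le> objective K1 K2 c d (l, \<rho>, t, u)"
proof -
  note pi = constrained_simplex_eqs[OF pi]
  have rho: "\<And>k. k \<in> {1..K2} \<Longrightarrow> \<rho> k \<le> 0"
    and t: "\<And>p. p \<in> P \<Longrightarrow> R p u + (\<Sum>k=1..K1. l k * g k p) + (\<Sum>k=1..K2. \<rho> k * h k p) \<le> t"
    using feas by (auto simp: feasible_set_def)
  have "(\<Sum>p\<in>P. \<pi> p * R p u)
      \<le> (\<Sum>p\<in>P. \<pi> p * (t - (\<Sum>k=1..K1. l k * g k p) - (\<Sum>k=1..K2. \<rho> k * h k p)))"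
    using pi(2) t by (intro sum_mono mult_left_mono) (force simp: algebra_simps)+
  also have "\<dots> = t - (\<Sum>k=1..K1. l k * (\<Sum>p\<in>P. g k p * \<pi> p))
      - (\<Sum>k=1..K2. \<rho> k * (\<Sum>p\<in>P. h k p * \<pi> p))"
    using pi(1)
    by (simp add: right_diff_distrib sum_subtractf sum_sum_mult_swap flip: sum_distrib_right)
  also have "(\<Sum>k=1..K1. l k * (\<Sum>p\<in>P. g k p * \<pi> p)) = (\<Sum>k=1..K1. l k * c k)"
    using pi(3) by (intro sum.cong) auto
  finally have "(\<Sum>p\<in>P. \<pi> p * R p u)
      \<le> t - (\<Sum>k=1..K1. l k * c k) - (\<Sum>k=1..K2. \<rho> k * (\<Sum>p\<in>P. h k p * \<pi> p))" .
  moreover have "(\<Sum>k=1..K2. \<rho> k * d k) \<le> (\<Sum>k=1..K2. \<rho> k * (\<Sum>p\<in>P. h k p * \<pi> p))"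
    using pi(4) rho by (intro sum_mono mult_left_mono_neg) auto
  ultimately show ?thesis by (simp add: objective_def)
qed

section \<open>Alternatives for finitely many points of the uncertainty set\<close>

text \<open>Farkas' lemma is applied to the constant functional 1. As the total mass is one on the
  simplex, a constant such as \<open>c k\<close> is absorbed into the homogeneous functional
  \<open>g k p - c k\<close>. A solution of positive total mass would rescale to an excluded
  \<open>\<pi>\<close>, so multipliers exist.\<close>

lemma constrained_simplex_alternative:
  fixes g h :: "nat \<Rightarrow> 'p \<Rightarrow> real" and r :: "'j \<Rightarrow> 'p \<Rightarrow> real"
  assumes "finite P" and "finite J"
    and no_pi: "\<not> (\<exists>\<pi>\<in>constrained_simplex P K1 K2 g h c d. \<forall>j\<in>J. v \<le> (\<Sum>p\<in>P. r j p * \<pi> p))"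
  obtains l m w where "\<And>k. k \<in> {1..K2} \<Longrightarrow> 0 \<le> m k" and "\<And>j. j \<in> J \<Longrightarrow> 0 \<le> w j"
    and "\<And>p. p \<in> P \<Longrightarrow> 1 \<le> (\<Sum>k=1..K1. l k * (g k p - c k)) + (\<Sum>k=1..K2. m k * (h k p - d k))
           + (\<Sum>j\<in>J. w j * (v - r j p))"
proof -
  \<comment> \<open>The two copies of \<open>{1..K1}\<close> split each equality into opposite
    inequalities. The summand \<open>P\<close> carries the negated coordinate functionals, which
    force \<open>x\<close> to be nonnegative on \<open>P\<close>.\<close>
  define I where "I = {1..K1} <+> {1..K1} <+> {1..K2} <+> J <+> P"
  define a :: "nat + nat + nat + 'j + 'p \<Rightarrow> 'p \<Rightarrow> real" where
    "a = case_sum (\<lambda>k p. g k p - c k) (case_sum (\<lambda>k p. c k - g k p) (case_sum (\<lambda>k p. h k p - d k)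
          (case_sum (\<lambda>j p. v - r j p) (\<lambda>q p. - of_bool (p = q)))))"
  have "finite I" using assms by (simp add: I_def)
  have "\<not> (\<exists>x. (\<forall>i\<in>I. (\<Sum>p\<in>P. a i p * x p) \<le> 0) \<and> 0 < (\<Sum>p\<in>P. 1 * x p))"
  proof
    assume "\<exists>x. (\<forall>i\<in>I. (\<Sum>p\<in>P. a i p * x p) \<le> 0) \<and> 0 < (\<Sum>p\<in>P. 1 * x p)"
    then obtain x where x: "\<And>i. i \<in> I \<Longrightarrow> (\<Sum>p\<in>P. a i p * x p) \<le> 0" and pos: "0 < (\<Sum>p\<in>P. x p)"
      by auto
    define s where "s = (\<Sum>p\<in>P. x p)"
    have s: "0 < s" using pos by (simp add: s_def)
    \<comment> \<open>Rescaled to total mass one, and restricted to \<open>P\<close> because the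
      simplex consists of extensional functions.\<close>
    define \<pi> where "\<pi> = (\<lambda>p\<in>P. x p / s)"
    have sum_pi: "(\<Sum>p\<in>P. f p * \<pi> p) = (\<Sum>p\<in>P. f p * x p) / s" for f :: "'p \<Rightarrow> real"
      by (simp add: \<pi>_def sum_divide_distrib)
    have split: "(\<Sum>p\<in>P. (f p - e) * x p) = (\<Sum>p\<in>P. f p * x p) - e * s"
                "(\<Sum>p\<in>P. (e - f p) * x p) = e * s - (\<Sum>p\<in>P. f p * x p)" for f :: "'p \<Rightarrow> real" and e
      by (simp_all add: s_def left_diff_distrib sum_subtractf sum_distrib_left)
    note x = x[unfolded I_def]
    have "0 \<le> x q" if "q \<in> P" for q
      using x[OF InrI[OF InrI[OF InrI[OF InrI[OF that]]]]] that \<open>finite P\<close>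
      by (auto simp: a_def sum_negf of_bool_def if_distrib[of "\<lambda>z. z * _"] sum.delta cong: if_cong)
    moreover have "(\<Sum>p\<in>P. g k p * x p) = c k * s" if "k \<in> {1..K1}" for k
      using x[OF InlI[OF that]] x[OF InrI[OF InlI[OF that]]] by (simp add: a_def split)
    moreover have "(\<Sum>p\<in>P. h k p * x p) \<le> d k * s" if "k \<in> {1..K2}" for k
      using x[OF InrI[OF InrI[OF InlI[OF that]]]] by (simp add: a_def split)
    moreover have "(\<Sum>p\<in>P. \<pi> p) = 1"
      using sum_pi[of "\<lambda>_. 1"] s by (simp add: s_def)
    ultimately have "\<pi> \<in> constrained_simplex P K1 K2 g h c d"
      using s unfolding constrained_simplex_def prob_simplex_def
      by (auto simp: sum_pi divide_simps) (auto simp: \<pi>_def)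
    moreover have "v \<le> (\<Sum>p\<in>P. r j p * \<pi> p)" if "j \<in> J" for j
      using x[OF InrI[OF InrI[OF InrI[OF InlI[OF that]]]]] s
      by (simp add: a_def split sum_pi divide_simps)
    ultimately show False using no_pi by blast
  qed
  then obtain y where y: "\<forall>i\<in>I. 0 \<le> y i" "\<forall>p\<in>P. 1 = (\<Sum>i\<in>I. y i * a i p)"
    using farkas_finite[OF \<open>finite I\<close> \<open>finite P\<close>, of "\<lambda>_. 1" a] by blast
  \<comment> \<open>The two nonnegative multipliers of an equality combine into one of arbitrary
    sign.\<close>
  define l where "l = (\<lambda>k. y (Inl k) - y (Inr (Inl k)))"
  define m where "m = (\<lambda>k. y (Inr (Inr (Inl k))))"
  define w where "w = (\<lambda>j. y (Inr (Inr (Inr (Inl j)))))"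
  define n where "n = (\<lambda>p. y (Inr (Inr (Inr (Inr p)))))"
  show thesis
  proof (rule that[of m w l])
    show "0 \<le> m k" if "k \<in> {1..K2}" for k using y(1) that by (auto simp: m_def I_def)
    show "0 \<le> w j" if "j \<in> J" for j using y(1) that by (auto simp: w_def I_def)
    show "1 \<le> (\<Sum>k=1..K1. l k * (g k p - c k)) + (\<Sum>k=1..K2. m k * (h k p - d k))
           + (\<Sum>j\<in>J. w j * (v - r j p))" if "p \<in> P" for p
    proof -
      have "0 \<le> n q" if "q \<in> P" for q using y(1) that by (auto simp: n_def I_def)
      \<comment> \<open>The nonnegativity rows contribute at most zero, so dropping them turns the
        Farkas identity into an inequality.\<close>
      then have n: "(\<Sum>q\<in>P. n q * - of_bool (p = q)) \<le> 0"
        by (intro sum_nonpos) auto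
      have "1 = (\<Sum>i\<in>I. y i * a i p)" using y(2) that by blast
      also have "\<dots> = (\<Sum>k=1..K1. y (Inl k) * (g k p - c k)) + ((\<Sum>k=1..K1. y (Inr (Inl k)) * (c k - g k p))
          + ((\<Sum>k=1..K2. m k * (h k p - d k)) + ((\<Sum>j\<in>J. w j * (v - r j p))
          + (\<Sum>q\<in>P. n q * - of_bool (p = q)))))"
        unfolding I_def using assms(1,2) by (simp add: sum.Plus a_def m_def w_def n_def o_def del: mult_minus_right)
      also have "(\<Sum>k=1..K1. y (Inr (Inl k)) * (c k - g k p)) = - (\<Sum>k=1..K1. y (Inr (Inl k)) * (g k p - c k))"
        by (simp add: right_diff_distrib sum_subtractf)
      finally show ?thesis
        using n by (simp add: l_def left_diff_distrib sum_subtractf)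
    qed
  qed
qed

text \<open>Dividing the multipliers by the total weight \<open>W\<close> on \<open>J\<close> turns
  the weights into convex coefficients. Their mean point \<open>u\<close> lies in \<open>U\<close>,
  and Jensen's inequality bounds \<open>R p u\<close>. Negating the remaining multipliers gives dual
  variables of the right sign.\<close>

lemma feasible_point_of_finite_infeasibility:
  fixes U :: "'u::real_vector set"
  assumes "finite P" and "convex U" and cvx: "\<And>p. p \<in> P \<Longrightarrow> convex_on U (R p)"
    and ne: "constrained_simplex P K1 K2 g h c d \<noteq> {}"
    and J: "finite J" "J \<subseteq> U"
    and no_pi: "\<not> (\<exists>\<pi>\<in>constrained_simplex P K1 K2 g h c d. \<forall>u\<in>J. v \<le> (\<Sum>p\<in>P. R p u * \<pi> p))"
  obtains x where "x \<in> feasible_set P U R K1 K2 g h" and "objective K1 K2 c d x = v"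
proof -
  obtain l m w where m: "\<And>k. k \<in> {1..K2} \<Longrightarrow> 0 \<le> m k" and w: "\<And>u. u \<in> J \<Longrightarrow> 0 \<le> w u"
    and le: "\<And>p. p \<in> P \<Longrightarrow> 1 \<le> (\<Sum>k=1..K1. l k * (g k p - c k)) + (\<Sum>k=1..K2. m k * (h k p - d k))
           + (\<Sum>u\<in>J. w u * (v - R p u))"
    by (rule constrained_simplex_alternative[OF \<open>finite P\<close> J(1) no_pi]) blast
  define W where "W = (\<Sum>u\<in>J. w u)"
  \<comment> \<open>Without weight on \<open>J\<close>, averaging the inequality against a point of
    the constrained simplex would give \<open>1 \<le> 0\<close>. This is where nonemptiness
    enters.\<close>
  have "W \<noteq> 0"
  proof
    assume "W = 0"
    then have "\<forall>u\<in>J. w u = 0" using w J(1) by (simp add: W_def sum_nonneg_eq_0_iff)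
    then have le0: "1 \<le> (\<Sum>k=1..K1. l k * (g k p - c k)) + (\<Sum>k=1..K2. m k * (h k p - d k))" if "p \<in> P" for p
      using le[OF that] by simp
    from ne obtain \<pi> where "\<pi> \<in> constrained_simplex P K1 K2 g h c d" by blast
    note pi = constrained_simplex_eqs[OF this]
    have "1 = (\<Sum>p\<in>P. \<pi> p * 1)" using pi(1) by simp
    also have "\<dots> \<le> (\<Sum>p\<in>P. \<pi> p * ((\<Sum>k=1..K1. l k * (g k p - c k)) + (\<Sum>k=1..K2. m k * (h k p - d k))))"
      using pi(2) le0 by (intro sum_mono mult_left_mono) auto
    also have "\<dots> = (\<Sum>k=1..K1. l k * (\<Sum>p\<in>P. (g k p - c k) * \<pi> p))
        + (\<Sum>k=1..K2. m k * (\<Sum>p\<in>P. (h k p - d k) * \<pi> p))"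
      by (simp add: distrib_left sum.distrib sum_sum_mult_swap)
    also have "\<dots> = (\<Sum>k=1..K1. l k * ((\<Sum>p\<in>P. g k p * \<pi> p) - c k))
        + (\<Sum>k=1..K2. m k * ((\<Sum>p\<in>P. h k p * \<pi> p) - d k))"
      using pi(1) by (simp add: left_diff_distrib sum_subtractf flip: sum_distrib_left)
    also have "\<dots> \<le> 0 + 0"
      using pi(3,4) m by (intro add_mono sum_nonpos) (auto simp: mult_nonneg_nonpos)
    finally show False by simp
  qed
  moreover have "0 \<le> W" unfolding W_def using w by (rule sum_nonneg)
  ultimately have W: "0 < W" by simp
  define u where "u = (\<Sum>u\<in>J. (w u / W) *\<^sub>R u)"
  define l' where "l' = (\<lambda>k\<in>{1..K1}. - l k / W)"
  define \<rho> where "\<rho> = (\<lambda>k\<in>{1..K2}. - m k / W)"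
  \<comment> \<open>Chosen so that the objective value is exactly \<open>v\<close>; what remains is
    to verify the epigraph constraints.\<close>
  define t where "t = v + (\<Sum>k=1..K1. l' k * c k) + (\<Sum>k=1..K2. \<rho> k * d k)"
  have sum1: "(\<Sum>u\<in>J. w u / W) = 1" using W by (simp add: W_def flip: sum_divide_distrib)
  have "u \<in> U"
    unfolding u_def using J w W sum1 \<open>convex U\<close> by (intro convex_sum) auto
  moreover have "R p u + (\<Sum>k=1..K1. l' k * g k p) + (\<Sum>k=1..K2. \<rho> k * h k p) \<le> t" if p: "p \<in> P" for p
  proof -
    have "J \<noteq> {}" using sum1 by auto
    then have "R p u \<le> (\<Sum>u\<in>J. w u / W * R p u)"
      unfolding u_def using J w W sum1 cvx[OF p] \<open>convex U\<close>
      by (intro convex_on_sum[where C = U]) auto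
    \<comment> \<open>The lower bound 1 is weakened to 0 before dividing by \<open>W\<close>; its
      positivity has served to exclude \<open>W = 0\<close>.\<close>
    moreover have "0 \<le> ((\<Sum>k=1..K1. l k * (g k p - c k)) + (\<Sum>k=1..K2. m k * (h k p - d k))
           + (\<Sum>u\<in>J. w u * (v - R p u))) / W"
      using le[OF p] W by (intro divide_nonneg_pos) auto
    moreover have "(\<Sum>u\<in>J. w u * (v - R p u)) / W = v - (\<Sum>u\<in>J. w u / W * R p u)"
      using W by (simp add: W_def right_diff_distrib sum_subtractf diff_divide_distrib
            flip: sum_distrib_right sum_divide_distrib)
    moreover have "(\<Sum>k=1..K1. l k * (g k p - c k)) / W = (\<Sum>k=1..K1. l' k * c k) - (\<Sum>k=1..K1. l' k * g k p)"
      unfolding sum_divide_distrib sum_subtractf[symmetric]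
      by (intro sum.cong) (auto simp: l'_def diff_divide_distrib right_diff_distrib)
    moreover have "(\<Sum>k=1..K2. m k * (h k p - d k)) / W = (\<Sum>k=1..K2. \<rho> k * d k) - (\<Sum>k=1..K2. \<rho> k * h k p)"
      unfolding sum_divide_distrib sum_subtractf[symmetric]
      by (intro sum.cong) (auto simp: \<rho>_def diff_divide_distrib right_diff_distrib)
    ultimately show ?thesis by (simp add: add_divide_distrib t_def)
  qed
  ultimately have "(l', \<rho>, t, u) \<in> feasible_set P U R K1 K2 g h"
    using m W by (auto simp: feasible_set_def l'_def \<rho>_def divide_nonneg_pos)
  moreover have "objective K1 K2 c d (l', \<rho>, t, u) = v"
    by (simp add: objective_def t_def)
  ultimately show thesis by (rule that)
qed

section \<open>Compactness and strong duality\<close>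

text \<open>Points of the simplex take values in \<open>[0, 1]\<close> on \<open>P\<close> and are
  \<open>undefined\<close> elsewhere. They lie in a product of compact sets over the whole index
  type, compact by Tychonoff, in which the remaining constraints cut out a closed set.\<close>

lemma compact_constrained_simplex:
  assumes "finite P"
  shows "compact (constrained_simplex P K1 K2 g h c d)"
proof -
  define B where "B = PiE UNIV (\<lambda>p. if p \<in> P then {0..1::real} else {undefined})"
  define C where "C = {\<pi>. (\<Sum>p\<in>P. \<pi> p) = 1} \<inter> (\<Inter>k\<in>{1..K1}. {\<pi>. (\<Sum>p\<in>P. g k p * \<pi> p) = c k}) \<inter>
        (\<Inter>k\<in>{1..K2}. {\<pi>. (\<Sum>p\<in>P. h k p * \<pi> p) \<le> d k})"
  have "compact B"
    unfolding B_def compactin_euclidean_iff[symmetric] euclidean_product_topology[symmetric]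
    by (subst compactin_PiE) auto
  moreover have "closed C"
    unfolding C_def
    by (intro closed_Int closed_INT ballI closed_Collect_eq closed_Collect_le continuous_intros
          continuous_on_product_coordinates)
  moreover have "constrained_simplex P K1 K2 g h c d = B \<inter> C"
  proof -
    have "\<pi> p \<le> 1" if "(\<Sum>p\<in>P. \<pi> p) = 1" "\<forall>p\<in>P. 0 \<le> \<pi> p" "p \<in> P" for \<pi> :: "'a \<Rightarrow> real" and p
      using member_le_sum[of p P \<pi>] that assms by auto
    then have "prob_simplex P = B \<inter> {\<pi>. (\<Sum>p\<in>P. \<pi> p) = 1}"
      by (auto simp: prob_simplex_def B_def PiE_iff extensional_def split: if_splits)
    then show ?thesis by (auto simp: constrained_simplex_def C_def)
  qed
  ultimately show ?thesis by auto
qed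

text \<open>Each \<open>u\<close> imposes a closed condition on \<open>\<pi>\<close>, so by the
  finite intersection property it suffices to satisfy finitely many at once. Failure would yield a
  feasible point of value exactly \<open>v\<close>, against the strict bound
  \<open>below\<close>.\<close>

lemma strong_duality:
  fixes U :: "'u::real_vector set"
  assumes "finite P" and "convex U" and "\<And>p. p \<in> P \<Longrightarrow> convex_on U (R p)"
    and "constrained_simplex P K1 K2 g h c d \<noteq> {}"
    and below: "\<And>x. x \<in> feasible_set P U R K1 K2 g h \<Longrightarrow> v < objective K1 K2 c d x"
  shows "\<exists>\<pi>\<in>constrained_simplex P K1 K2 g h c d. \<forall>u\<in>U. v \<le> (\<Sum>p\<in>P. R p u * \<pi> p)"
proof -
  let ?S = "constrained_simplex P K1 K2 g h c d"
  define C where "C u = {\<pi>. v \<le> (\<Sum>p\<in>P. R p u * \<pi> p)}" for u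
  have "?S \<inter> \<Inter>(C ` U) \<noteq> {}"
  proof (rule compact_imp_fip)
    show "compact ?S" using \<open>finite P\<close> by (rule compact_constrained_simplex)
    show "closed T" if "T \<in> C ` U" for T
      using that
      by (auto simp: C_def intro!: closed_Collect_le continuous_intros continuous_on_product_coordinates)
    fix F assume "finite F" "F \<subseteq> C ` U"
    then obtain J where J: "J \<subseteq> U" "finite J" "F = C ` J" by (meson finite_subset_image)
    have "\<exists>\<pi>\<in>?S. \<forall>u\<in>J. v \<le> (\<Sum>p\<in>P. R p u * \<pi> p)"
    proof (rule ccontr)
      assume "\<not> ?thesis"
      with assms(1-4) J(2,1) obtain x where "x \<in> feasible_set P U R K1 K2 g h" "objective K1 K2 c d x = v"
        by (rule feasible_point_of_finite_infeasibility)
      with below show False by fastforce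
    qed
    then show "?S \<inter> \<Inter>F \<noteq> {}" by (auto simp: J(3) C_def)
  qed
  then show ?thesis by (auto simp: C_def)
qed

section \<open>Convexity of the minimisation problem\<close>

text \<open>Each constraint bounds by \<open>t\<close> the sum of \<open>R p u\<close>, convex in
  \<open>u\<close>, and terms linear in the multipliers. The objective is linear, so its convexity
  inequality holds with equality.\<close>

lemma convex_program_feasible_set:
  fixes U :: "'u::real_vector set"
  assumes "convex U" and cvx: "\<And>p. p \<in> P \<Longrightarrow> convex_on U (R p)"
  shows "convex_program K1 K2 (feasible_set P U R K1 K2 g h) (objective K1 K2 c d)"
  unfolding convex_program_def
proof (intro ballI)
  fix x y and s :: real
  assume x: "x \<in> feasible_set P U R K1 K2 g h" and y: "y \<in> feasible_set P U R K1 K2 g h"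
    and s: "s \<in> {0..1}"
  obtain l \<rho> t u where x_eq: "x = (l, \<rho>, t, u)" by (cases x)
  obtain l' \<rho>' t' u' where y_eq: "y = (l', \<rho>', t', u')" by (cases y)
  \<comment> \<open>The restricted lambda is the form in which \<open>tuple_comb\<close> produces
    multipliers, so this rewrites all sums in the constraints and in the objective.\<close>
  have lin: "(\<Sum>k=1..K. (\<lambda>k\<in>{1..K}. (1 - s) * f k + s * f' k) k * e k)
      = (1 - s) * (\<Sum>k=1..K. f k * e k) + s * (\<Sum>k=1..K. f' k * e k)" for K :: nat and f f' e
    unfolding sum_distrib_left sum.distrib[symmetric] by (intro sum.cong) (auto simp: algebra_simps)
  have u: "u \<in> U" "u' \<in> U" using x y by (auto simp: x_eq y_eq feasible_set_def)
  have "(1 - s) *\<^sub>R u + s *\<^sub>R u' \<in> U"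
    using u s \<open>convex U\<close> by (intro convexD) auto
  moreover have "(1 - s) * \<rho> k + s * \<rho>' k \<le> 0" if "k \<in> {1..K2}" for k
    using x y s that by (intro add_nonpos_nonpos mult_nonneg_nonpos) (auto simp: x_eq y_eq feasible_set_def)
  moreover have "R p ((1 - s) *\<^sub>R u + s *\<^sub>R u')
        + ((1 - s) * (\<Sum>k=1..K1. l k * g k p) + s * (\<Sum>k=1..K1. l' k * g k p))
        + ((1 - s) * (\<Sum>k=1..K2. \<rho> k * h k p) + s * (\<Sum>k=1..K2. \<rho>' k * h k p))
        \<le> (1 - s) * t + s * t'" if p: "p \<in> P" for p
  proof -
    have "R p ((1 - s) *\<^sub>R u + s *\<^sub>R u') \<le> (1 - s) * R p u + s * R p u'"
      using cvx[OF p] s u by (intro convex_onD) auto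
    moreover have "(1 - s) * (R p u + (\<Sum>k=1..K1. l k * g k p) + (\<Sum>k=1..K2. \<rho> k * h k p)) \<le> (1 - s) * t"
      using x p s by (intro mult_left_mono) (auto simp: x_eq feasible_set_def)
    moreover have "s * (R p u' + (\<Sum>k=1..K1. l' k * g k p) + (\<Sum>k=1..K2. \<rho>' k * h k p)) \<le> s * t'"
      using y p s by (intro mult_left_mono) (auto simp: y_eq feasible_set_def)
    ultimately show ?thesis by (simp add: distrib_left)
  qed
  ultimately have "tuple_comb K1 K2 s x y \<in> feasible_set P U R K1 K2 g h"
    unfolding feasible_set_def x_eq y_eq tuple_comb_def prod.case mem_Collect_eq lin by simp
  moreover have "objective K1 K2 c d (tuple_comb K1 K2 s x y)
      = (1 - s) * objective K1 K2 c d x + s * objective K1 K2 c d y"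
    unfolding objective_def x_eq y_eq tuple_comb_def prod.case lin by (simp add: algebra_simps)
  ultimately show "tuple_comb K1 K2 s x y \<in> feasible_set P U R K1 K2 g h \<and>
      objective K1 K2 c d (tuple_comb K1 K2 s x y)
        \<le> (1 - s) * objective K1 K2 c d x + s * objective K1 K2 c d y"
    by simp
qed

section \<open>Equality of the optimal values in the extended reals\<close>

theorem mainTheorem10:
  fixes P :: "(real ^ 'i) set"
    and U :: "(real ^ 'm) set"
    and R :: "real ^ 'i \<Rightarrow> real ^ 'm \<Rightarrow> real"
    and K1 K2 :: nat
    and g h :: "nat \<Rightarrow> real ^ 'i \<Rightarrow> real"
    and c d :: "nat \<Rightarrow> real"
  assumes "finite P" and "P \<noteq> {}" and "\<forall>p\<in>P. \<forall>i. 0 \<le> p $ i"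
    and "convex U" and "U \<noteq> {}"
    and "\<forall>p\<in>P. convex_on U (R p)"
    and "constrained_simplex P K1 K2 g h c d \<noteq> {}"
  shows "(SUP \<pi>\<in>constrained_simplex P K1 K2 g h c d.
            INF u\<in>U. ereal (\<Sum>p\<in>P. \<pi> p * R p u))
         = (INF x\<in>feasible_set P U R K1 K2 g h. ereal (objective K1 K2 c d x))
       \<and> convex_program K1 K2 (feasible_set P U R K1 K2 g h) (objective K1 K2 c d)"
proof
  let ?S = "constrained_simplex P K1 K2 g h c d" and ?F = "feasible_set P U R K1 K2 g h"
  have cvx: "convex_on U (R p)" if "p \<in> P" for p using assms(6) that by blast
  show "convex_program K1 K2 ?F (objective K1 K2 c d)"
    using assms(4) cvx by (rule convex_program_feasible_set)
  show "(SUP \<pi>\<in>?S. INF u\<in>U. ereal (\<Sum>p\<in>P. \<pi> p * R p u)) = (INF x\<in>?F. ereal (objective K1 K2 c d x))"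
  proof (rule antisym)
    show "(SUP \<pi>\<in>?S. INF u\<in>U. ereal (\<Sum>p\<in>P. \<pi> p * R p u)) \<le> (INF x\<in>?F. ereal (objective K1 K2 c d x))"
    proof (intro SUP_least INF_greatest)
      fix \<pi> x assume pi: "\<pi> \<in> ?S" and x: "x \<in> ?F"
      obtain l \<rho> t u where x_eq: "x = (l, \<rho>, t, u)" by (cases x)
      have "u \<in> U" using x by (simp add: x_eq feasible_set_def)
      then show "(INF u\<in>U. ereal (\<Sum>p\<in>P. \<pi> p * R p u)) \<le> ereal (objective K1 K2 c d x)"
        using weak_duality[OF pi x[unfolded x_eq]] by (intro INF_lower2[of u]) (simp_all add: x_eq)
    qed
    show "(INF x\<in>?F. ereal (objective K1 K2 c d x)) \<le> (SUP \<pi>\<in>?S. INF u\<in>U. ereal (\<Sum>p\<in>P. \<pi> p * R p u))"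
    proof (rule ccontr)
      assume "\<not> ?thesis"
      \<comment> \<open>A gap between two extended reals contains a real \<open>v\<close>, so
        infinite optimal values need no separate cases.\<close>
      then obtain v where v: "(SUP \<pi>\<in>?S. INF u\<in>U. ereal (\<Sum>p\<in>P. \<pi> p * R p u)) < ereal v"
          "ereal v < (INF x\<in>?F. ereal (objective K1 K2 c d x))"
        using ereal_dense2 by (auto simp: not_le)
      have "v < objective K1 K2 c d x" if "x \<in> ?F" for x
        using less_INF_D[OF v(2) that] by simp
      with assms(1,4) cvx assms(7) have "\<exists>\<pi>\<in>?S. \<forall>u\<in>U. v \<le> (\<Sum>p\<in>P. R p u * \<pi> p)"
        by (rule strong_duality)
      then obtain \<pi> where pi: "\<pi> \<in> ?S" "\<forall>u\<in>U. v \<le> (\<Sum>p\<in>P. R p u * \<pi> p)" by blast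
      then have "ereal v \<le> (INF u\<in>U. ereal (\<Sum>p\<in>P. \<pi> p * R p u))"
        by (intro INF_greatest) (simp add: mult.commute)
      also have "\<dots> \<le> (SUP \<pi>\<in>?S. INF u\<in>U. ereal (\<Sum>p\<in>P. \<pi> p * R p u))"
        using pi(1) by (rule SUP_upper)
      finally show False using v(1) by simp
    qed
  qed
qed

end
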